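(* Let $m\geq 1$ be an integer and $q=3^m$. Let $a,b,c\in\mathbb{F}_q$ with $b\neq 0$ and $c\neq 0$, and let $$f(x)=b^3(x+a)^4+c(x+a)-a\in\mathbb{F}_q[x].$$ Let $(\alpha_n)_{n\geq 0}$ be a sequence with $\alpha_0=0$ and, for each $n\geq 1$, $\alpha_n\in\mathbb{F}_{q^{4^n}}$ and $f(\alpha_n)=\alpha_{n-1}$; and let $\beta_n=b(\alpha_n+a)\in\mathbb{F}_{q^{4^n}}$ for each $n\geq 0$. Then $f(x)$ is stable over $\mathbb{F}_{3^m}$ if and only if for every integer $n\geq 0$ the polynomial $x^3+\beta_n x-c^2$ has a unique root in $\mathbb{F}_{3^{4^n m}}$ and this root is a non-square in $\mathbb{F}_{3^{4^n m}}$.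
   Context: For a field $K$, a polynomial $t(x)\in K[x]$ is called stable over $K$ if for every integer $n\ge 1$ the $n$-th iterate $t^{(n)}(x)=t(t(\cdots t(x)\cdots))$ ($n$-fold composition) is irreducible over $K$. All fields $\mathbb{F}_{q^{4^n}}=\mathbb{F}_{3^{4^n m}}$ are taken inside a fixed algebraic closure of $\mathbb{F}_q$. A sequence $(\alpha_n)$ as described always exists, because for every quartic polynomial $f\in\mathbb{F}_q[x]$, every $r\geq 1$ and every $e\in\mathbb{F}_{q^r}$, the polynomial $f(x)-e$ has a root in $\mathbb{F}_{q^{4r}}$; the statement holds for any such choice of sequence. *)

theory Defs
  imports "HOL-Library.Cardinality" "HOL-Algebra.Algebraic_Closure_Type"
begin

definition poly_iterate :: "'a::comm_semiring_1 poly \<Rightarrow> nat \<Rightarrow> 'a poly" where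
  "poly_iterate t n = (pcompose t ^^ n) [:0, 1:]"

definition stable_poly :: "'a::field poly \<Rightarrow> bool" where
  "stable_poly t \<longleftrightarrow> (\<forall>n\<ge>1. Factorial_Ring.irreducible (poly_iterate t n))"

(* With q = CARD('a), the subfield of order q^k of the algebraic closure of the finite field 'a,
   i.e. the set of roots of X^(q^k) - X. The lemmas below show that, for k > 0, it is the unique
   subfield with q^k elements. *)
definition ext_field :: "nat \<Rightarrow> 'a::{field, finite} alg_closure set" where
  "ext_field k = {x. x ^ (CARD('a) ^ k) = x}"

lemma poly_poly_iterate: "poly (poly_iterate t n) x = (poly t ^^ n) x"
  by (induction n) (auto simp: poly_iterate_def poly_pcompose)

lemma CHAR_eq_of_CARD:
  assumes "Factorial_Ring.prime p" "CARD('a::{field, finite}) = p ^ m"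
  shows "CHAR('a) = p"
proof -
  have "CHAR('a) > 0"
    by (rule finite_imp_CHAR_pos) auto
  hence "Factorial_Ring.prime CHAR('a)"
    by (rule prime_CHAR_semidom)
  moreover have "(\<Sum>x\<in>UNIV. x + (1::'a)) = (\<Sum>x\<in>UNIV. x)"
    by (rule sum.reindex_bij_witness[of _ "\<lambda>x. x - 1" "\<lambda>x. x + 1"]) auto
  hence "of_nat (p ^ m) = (0::'a)"
    by (simp add: sum.distrib assms(2) del: of_nat_power)
  hence "CHAR('a) dvd p ^ m"
    by (simp only: of_nat_eq_0_iff_char_dvd)
  ultimately show ?thesis
    using assms(1) by (metis prime_dvd_power primes_dvd_imp_eq)
qed

context
  fixes p m k :: nat and F :: "'a::{field, finite} alg_closure set"
  assumes p: "Factorial_Ring.prime p" and card: "CARD('a) = p ^ m"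
  defines "F \<equiv> ext_field k"
begin

lemma ext_field_add: "x \<in> F \<Longrightarrow> y \<in> F \<Longrightarrow> x + y \<in> F"
proof -
  have "CHAR('a alg_closure) = p"
    using CHAR_eq_of_CARD[OF p card] by simp
  hence "(x + y) ^ (p ^ (m * k)) = x ^ (p ^ (m * k)) + y ^ (p ^ (m * k))"
    by (intro freshmans_dream'[where n = "m * k"]) (use p in auto)
  thus "x \<in> F \<Longrightarrow> y \<in> F \<Longrightarrow> x + y \<in> F"
    by (auto simp: F_def ext_field_def card simp flip: power_mult)
qed

lemma ext_field_mult: "x \<in> F \<Longrightarrow> y \<in> F \<Longrightarrow> x * y \<in> F"
  by (auto simp: F_def ext_field_def power_mult_distrib)

lemma ext_field_0: "0 \<in> F" and ext_field_1: "1 \<in> F"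
  by (auto simp: F_def ext_field_def)

lemma ext_field_inverse: "x \<in> F \<Longrightarrow> inverse x \<in> F"
  by (auto simp: F_def ext_field_def power_inverse)

lemma ext_field_uminus: "x \<in> F \<Longrightarrow> - x \<in> F"
proof -
  have "of_nat p = (0 :: 'a alg_closure)"
    using CHAR_eq_of_CARD[OF p card] by (simp add: of_nat_eq_0_iff_char_dvd)
  hence "(-1 :: 'a alg_closure) = of_nat (p - 1)"
    using prime_gt_0_nat[OF p] by (simp add: of_nat_diff)
  also have "of_nat n \<in> F" for n
    by (induction n) (auto intro: ext_field_0 ext_field_1 ext_field_add)
  finally show "x \<in> F \<Longrightarrow> - x \<in> F"
    using ext_field_mult[of "-1" x] by simp
qed

lemma card_ext_field:
  assumes "k > 0"
  shows "card F = CARD('a) ^ k"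
proof -
  define N where "N = CARD('a) ^ k"
  define P :: "'a alg_closure poly" where "P = monom 1 N - [:0, 1:]"
  have m: "m > 0"
  proof (rule Nat.gr0I)
    assume "m = 0"
    hence "card (UNIV :: 'a set) = 1"
      using card by simp
    then obtain z :: 'a where "UNIV = {z}"
      by (rule card_1_singletonE)
    hence "(0::'a) = 1"
      by (metis UNIV_I singletonD)
    thus False by simp
  qed
  have "p dvd N"
    using m assms by (auto simp: N_def card simp flip: power_mult)
  moreover have "N > 0"
    using prime_gt_0_nat[OF p] by (simp add: N_def card)
  ultimately have N: "N > 1"
    using dvd_imp_le[of p N] prime_gt_1_nat[OF p] by linarith
  have N0: "of_nat N = (0 :: 'a alg_closure)"
    using \<open>p dvd N\<close> CHAR_eq_of_CARD[OF p card] by (simp add: of_nat_eq_0_iff_char_dvd)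
  have cf: "coeff P N = 1" "\<And>i. i > N \<Longrightarrow> coeff P i = 0"
    using N by (auto simp: P_def coeff_pCons split: nat.splits)
  have deg: "degree P = N"
    using cf by (intro antisym degree_le le_degree) auto
  have P0: "P \<noteq> 0" using cf by auto
  have dP: "pderiv P = [:-1:]"
    using N0 by (simp add: P_def pderiv_diff pderiv_monom pderiv_pCons)
  obtain A where A: "size A = degree P" "P = smult (lead_coeff P) (\<Prod>x\<in>#A. [:-x, 1:])"
    using alg_closed_imp_factorization[OF P0] by blast
  have A2: "P = (\<Prod>x\<in>#A. [:-x, 1:])"
    using A(2) cf deg by simp
  have rt: "poly P x = 0 \<longleftrightarrow> x \<in># A" for x
    by (subst A2) (auto simp: poly_prod_mset image_iff)
  have "count A x \<le> 1" for x
  proof (rule ccontr)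
    assume "\<not> count A x \<le> 1"
    hence "replicate_mset 2 x \<subseteq># A"
      by (simp add: count_le_replicate_mset_subset_eq [symmetric])
    then obtain B where B: "A = replicate_mset 2 x + B"
      by (auto simp: subset_mset.le_iff_add)
    have "P = [:-x, 1:] * ([:-x, 1:] * (\<Prod>x\<in>#B. [:-x, 1:]))"
      by (subst A2) (simp add: B numeral_2_eq_2 mult.assoc)
    hence "poly (pderiv P) x = 0"
      by (simp only: pderiv_mult) simp
    thus False by (simp add: dP)
  qed
  hence "count A x = 1" if "x \<in># A" for x
    using that by (simp add: le_antisym Suc_leI)
  hence "size A = card (set_mset A)"
    by (simp add: size_multiset_overloaded_eq)
  also have "set_mset A = F"
    using rt by (auto simp: F_def ext_field_def P_def poly_monom N_def)
  finally show ?thesis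
    using A(1) deg by (simp add: N_def)
qed

lemma ext_field_unique:
  assumes S: "0 \<in> S" "\<And>x y. x \<in> S \<Longrightarrow> y \<in> S \<Longrightarrow> x * y \<in> S"
    "\<And>x. x \<in> S \<Longrightarrow> inverse x \<in> S"
    and "card S = CARD('a) ^ k" "k > 0"
  shows "S = F"
proof -
  have pos: "CARD('a) ^ k > 0" by simp
  have fin: "finite S"
    using assms(4) pos by (metis card.infinite less_irrefl)
  have finF: "finite F"
    using card_ext_field[OF \<open>k > 0\<close>] pos by (metis card.infinite less_irrefl)
  have "x ^ card S = x" if x: "x \<in> S" for x
  proof (cases "x = 0")
    case True
    thus ?thesis using assms(4) by simp
  next
    case False
    have "(\<Prod>y\<in>S-{0}. x * y) = (\<Prod>y\<in>S-{0}. y)"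
      by (rule prod.reindex_bij_witness[of _ "\<lambda>y. inverse x * y" "\<lambda>y. x * y"])
         (use False x S in \<open>auto simp flip: mult.assoc\<close>)
    hence "x ^ card (S - {0}) * \<Prod>(S - {0}) = 1 * \<Prod>(S - {0})"
      by (simp add: prod.distrib)
    moreover have "\<Prod>(S - {0}) \<noteq> 0"
      using fin by simp
    ultimately have "x ^ card (S - {0}) = 1"
      by simp
    moreover have "card S = Suc (card (S - {0}))"
      using fin S(1) by (metis card.remove)
    ultimately show ?thesis by simp
  qed
  hence "S \<subseteq> F"
    using assms(4) by (auto simp: F_def ext_field_def)
  thus ?thesis
    using card_subset_eq[OF finF] card_ext_field[OF \<open>k > 0\<close>] assms(4) by metis
qed

end

end

theory Submission
  imports Defs
begin

text \<open>
  Let \<open>q = CARD('a)\<close>. Each \<open>\<alpha>\<^sub>n\<close> is a root of the iterate \<open>f\<^sup>n\<close> of degree \<open>4\<^sup>n\<close> and lies in the field with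
  \<open>q\<close> to the power \<open>4\<^sup>n\<close> elements. Counting Frobenius conjugates, that iterate is irreducible iff
  \<open>\<alpha>\<^sub>n\<close> does not lie in the subfield of index 2. Stability thus decouples into one condition per level:
  with \<open>F\<close> the field at level \<open>n\<close>, the element \<open>z = \<beta>\<^bsub>n+1\<^esub>\<close>, which satisfies \<open>z^4 + c z = \<beta>\<^sub>n\<close>, has
  degree 4 over \<open>F\<close>. The squares \<open>(z\<^sub>i + z\<^sub>j)\<^sup>2\<close> of sums of two distinct roots of this quartic are roots of
  its resolvent cubic, which in characteristic 3 is \<open>x^3 + \<beta>\<^sub>n x - c\<^sup>2\<close>. If Frobenius acts on the roots as a
  4-cycle, only \<open>(z\<^sub>0 + z\<^sub>2)\<^sup>2\<close> is fixed, and its square root \<open>z\<^sub>0 + z\<^sub>2\<close> changes sign. Conversely, two roots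
  swapped by Frobenius give a root of the cubic that is a square in \<open>F\<close>, and if \<open>z \<in> F\<close>, then
  every root \<open>r\<close> of the cubic in \<open>F\<close> is a square because \<open>(c + z r)\<^sup>2 = r (r - z\<^sup>2)\<^sup>2\<close>.
\<close>

section \<open>The resolvent cubic of \<open>z^4 + c z = d\<close> in characteristic 3\<close>

lemmas power_algebra_simps = algebra_simps power2_eq_square power3_eq_cube power4_eq_xxxx

text \<open>Subtracting the two equations and cancelling \<open>x - y\<close> expresses
  \<open>c\<close>, and then \<open>d\<close>, as polynomials in \<open>x\<close> and
  \<open>y\<close>; after substitution the two sides differ by a multiple of 3.\<close>

lemma resolvent_cubic_root:
  fixes x y c d :: "'a::field"
  assumes char3: "(3::'a) = 0" and "x \<noteq> y"
    and x: "x ^ 4 + c * x = d" and y: "y ^ 4 + c * y = d"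
  shows "((x + y)\<^sup>2) ^ 3 + d * (x + y)\<^sup>2 = c\<^sup>2"
proof -
  have "(x - y) * ((x + y) * (x\<^sup>2 + y\<^sup>2) + c) = (x ^ 4 + c * x) - (y ^ 4 + c * y)"
    by (simp add: power_algebra_simps)
  hence "(x - y) * ((x + y) * (x\<^sup>2 + y\<^sup>2) + c) = 0"
    by (simp only: x y diff_self)
  hence c: "c = - ((x + y) * (x\<^sup>2 + y\<^sup>2))"
    using \<open>x \<noteq> y\<close> by (simp add: eq_neg_iff_add_eq_0 add.commute)
  have d: "d = - (x * y * (x\<^sup>2 + x * y + y\<^sup>2))"
    unfolding x [symmetric] c by (simp add: power_algebra_simps)
  have "((x + y)\<^sup>2) ^ 3 + d * (x + y)\<^sup>2 - c\<^sup>2 =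
      3 * ((x + y)\<^sup>2 * (x * y * (x\<^sup>2 + x * y + y\<^sup>2)))"
    unfolding c d by (simp add: power_algebra_simps)
  thus ?thesis
    using char3 by simp
qed

text \<open>Unless \<open>r = z^2\<close>, dividing exhibits \<open>r\<close> as the square of
  \<open>(c + z * r) / (r - z^2)\<close>, so \<open>r\<close> is a square in every field containing
  \<open>c\<close>, \<open>z\<close> and \<open>r\<close>.\<close>

lemma resolvent_cubic_square:
  fixes z r c d :: "'a::field"
  assumes char3: "(3::'a) = 0"
    and z: "z ^ 4 + c * z = d" and r: "r ^ 3 + d * r = c\<^sup>2"
  shows "(c + z * r)\<^sup>2 = r * (r - z\<^sup>2)\<^sup>2"
proof -
  have "(c + z * r)\<^sup>2 - r * (r - z\<^sup>2)\<^sup>2 =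
      3 * (c * z * r + z\<^sup>2 * r\<^sup>2) + (c\<^sup>2 - (r ^ 3 + (z ^ 4 + c * z) * r))"
    by (simp add: power_algebra_simps)
  thus ?thesis
    unfolding z r using char3 by simp
qed

text \<open>In characteristic 3 the map \<open>t^3 + d t\<close> is additive in \<open>t\<close>, so
  the difference of two distinct solutions is a nonzero root of it.\<close>

lemma resolvent_cubic_difference:
  fixes x y c d :: "'a::field"
  assumes char3: "(3::'a) = 0"
    and "x ^ 3 + d * x = c" "y ^ 3 + d * y = c" "x \<noteq> y"
  shows "(x - y)\<^sup>2 = - d"
proof -
  have "(x - y) * ((x - y)\<^sup>2 + d) =
      (x ^ 3 + d * x) - (y ^ 3 + d * y) - 3 * (x * y * (x - y))"
    by (simp add: power_algebra_simps)
  hence "(x - y) * ((x - y)\<^sup>2 + d) = 0"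
    unfolding assms(2,3) using char3 by simp
  thus ?thesis
    using \<open>x \<noteq> y\<close> by (simp add: eq_neg_iff_add_eq_0)
qed

lemma square_eq_square_fixed:
  fixes x :: "'a::idom"
  assumes "\<And>t. \<sigma> (- t) = - \<sigma> t" "\<sigma> y = y" "y\<^sup>2 = x\<^sup>2"
  shows "\<sigma> x = x"
  using assms by (metis power2_eq_iff minus_minus)

text \<open>Here \<sigma> abstracts the Frobenius map of the field at one level, whose elements are
  its fixed points. By \<open>period\<close> the orbit of \<open>z\<close> has length 1, 2 or 4, and
  the left-hand side singles out length 4.\<close>

lemma quartic_fixed_iff_resolvent_cubic:
  fixes \<sigma> :: "'a::field \<Rightarrow> 'a" and c d z :: 'a
  assumes char3: "(3::'a) = 0"
    and add: "\<And>x y. \<sigma> (x + y) = \<sigma> x + \<sigma> y"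
    and mult: "\<And>x y. \<sigma> (x * y) = \<sigma> x * \<sigma> y"
    and one: "\<sigma> 1 = 1"
    and fixed: "\<sigma> c = c" "\<sigma> d = d"
    and z: "z ^ 4 + c * z = d" and period: "\<sigma> (\<sigma> (\<sigma> (\<sigma> z))) = z"
    and "c \<noteq> 0"
  shows "\<sigma> (\<sigma> z) \<noteq> z \<longleftrightarrow>
    (\<exists>x. {y. \<sigma> y = y \<and> y ^ 3 + d * y = c\<^sup>2} = {x} \<and> \<not> (\<exists>y. \<sigma> y = y \<and> y\<^sup>2 = x))"
proof -
  have [simp]: "\<sigma> 0 = 0"
    using add [of 0 0] by (metis add.right_neutral add_left_cancel)
  have uminus: "\<sigma> (- x) = - \<sigma> x" for x
    using add [of x "- x"] by (simp add: eq_neg_iff_add_eq_0 add.commute)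
  have diff: "\<sigma> (x - y) = \<sigma> x - \<sigma> y" for x y
    using add [of x "- y"] uminus by simp
  have power: "\<sigma> (x ^ k) = \<sigma> x ^ k" for x k
    by (induction k) (simp_all add: one mult)
  have inv: "\<sigma> (inverse x) = inverse (\<sigma> x)" for x
  proof (cases "x = 0")
    case False
    hence "\<sigma> x * \<sigma> (inverse x) = 1"
      by (simp add: one flip: mult)
    thus ?thesis
      by (metis inverse_unique)
  qed simp
  have div: "\<sigma> (x / y) = \<sigma> x / \<sigma> y" for x y
    by (simp add: divide_inverse mult inv)
  note hom = add mult one uminus diff power div fixed
  define z1 z2 z3 where "z1 = \<sigma> z" and "z2 = \<sigma> z1" and "z3 = \<sigma> z2"
  have [simp]: "\<sigma> z = z1" "\<sigma> z1 = z2" "\<sigma> z2 = z3" "\<sigma> z3 = z"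
    using period by (simp_all add: z1_def z2_def z3_def)
  have root: "\<sigma> x ^ 4 + c * \<sigma> x = d" if "x ^ 4 + c * x = d" for x
    using arg_cong [OF that, of \<sigma>] by (simp add: hom)
  have z1: "z1 ^ 4 + c * z1 = d" and z2: "z2 ^ 4 + c * z2 = d" and z3: "z3 ^ 4 + c * z3 = d"
    using root [OF z] root [of z1] root [of z2] by simp_all
  have two: "(2::'a) \<noteq> 0"
  proof
    assume "(2::'a) = 0"
    moreover have "(3::'a) - 2 = 1" by simp
    ultimately show False
      using char3 by (metis diff_self zero_neq_one)
  qed
  show ?thesis
  proof
    assume "\<sigma> (\<sigma> z) \<noteq> z"
    hence ne: "z2 \<noteq> z" by simp
    hence ne3: "z3 \<noteq> z1"
      using \<open>\<sigma> z2 = z3\<close> \<open>\<sigma> z3 = z\<close> \<open>\<sigma> z1 = z2\<close> by metis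
    have ne1: "z1 \<noteq> z" "z2 \<noteq> z1" "z3 \<noteq> z2" "z3 \<noteq> z"
      using ne ne3 \<open>\<sigma> z = z1\<close> \<open>\<sigma> z1 = z2\<close> \<open>\<sigma> z2 = z3\<close> \<open>\<sigma> z3 = z\<close> by metis+
    \<comment> \<open>Divided differences of the quartic at its four distinct conjugates:
      \<open>h\<close> is the first, \<open>h2\<close> the second, and the third, obtained below as
      \<open>sum\<close>, says that the four roots add up to 0.\<close>
    have h: "(x + y) * (x\<^sup>2 + y\<^sup>2) = - c" if "x ^ 4 + c * x = d" "y ^ 4 + c * y = d" "x \<noteq> y" for x y
    proof -
      have "(x - y) * ((x + y) * (x\<^sup>2 + y\<^sup>2) + c) = (x ^ 4 + c * x) - (y ^ 4 + c * y)"
        by (simp add: power_algebra_simps)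
      thus ?thesis
        unfolding that(1,2) using that(3) by (simp add: eq_neg_iff_add_eq_0)
    qed
    have h2: "z\<^sup>2 + z * z1 + z1\<^sup>2 + z * w + z1 * w + w\<^sup>2 = 0"
      if "w ^ 4 + c * w = d" "w \<noteq> z" "w \<noteq> z1" for w
    proof -
      have "(z1 - w) * (z\<^sup>2 + z * z1 + z1\<^sup>2 + z * w + z1 * w + w\<^sup>2) =
          (z + z1) * (z\<^sup>2 + z1\<^sup>2) - (z + w) * (z\<^sup>2 + w\<^sup>2)"
        by (simp add: power_algebra_simps)
      thus ?thesis
        using h [OF z z1] h [OF z that(1)] ne1 that by simp
    qed
    have "(z2 - z3) * (z1 + z3 + (z + z2)) =
        (z\<^sup>2 + z * z1 + z1\<^sup>2 + z * z2 + z1 * z2 + z2\<^sup>2) -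
        (z\<^sup>2 + z * z1 + z1\<^sup>2 + z * z3 + z1 * z3 + z3\<^sup>2)"
      by (simp add: power_algebra_simps)
    hence sum: "z1 + z3 = - (z + z2)"
      using h2 [OF z2 ne ne1(2)] h2 [OF z3 ne1(4) ne3] ne1
      by (simp del: minus_add_distrib add: eq_neg_iff_add_eq_0)
    define u where "u = z + z2"
    define y where "y = u\<^sup>2"
    have su: "\<sigma> u = - u"
      using sum by (simp add: u_def hom)
    have y: "\<sigma> y = y" "y ^ 3 + d * y = c\<^sup>2"
      using resolvent_cubic_root [OF char3 _ z z2] ne by (simp_all add: y_def hom su) (simp_all add: u_def)
    have "u \<noteq> 0"
      using y(2) \<open>c \<noteq> 0\<close> by (auto simp: y_def)
    hence "\<sigma> u \<noteq> u"
      unfolding su using two by (metis add.right_inverse mult_2 mult_eq_0_iff)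
    \<comment> \<open>The only square roots of \<open>y\<close> are \<open>u\<close> and
      \<open>- u\<close>, and \<sigma> fixes neither.\<close>
    hence nonsq: "\<not> (\<exists>v. \<sigma> v = v \<and> v\<^sup>2 = y)"
      using square_eq_square_fixed [of \<sigma>, OF uminus] unfolding y_def by blast
    \<comment> \<open>A second fixed root \<open>y'\<close> would make every root of the cubic
      fixed, since distinct roots differ by a square root of \<open>- d\<close>. Applied to
      \<open>w\<close>, this gives \<open>(z1 + z2)^2 = (z + z1)^2\<close>, which in characteristic
      3 forces \<open>u = z1\<close>; applying \<sigma> then yields \<open>z2 = - z1\<close> and
      \<open>z3 = z1\<close>.\<close>
    have "y' = y" if y': "\<sigma> y' = y'" "y' ^ 3 + d * y' = c\<^sup>2" for y'
    proof (rule ccontr)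
      assume "y' \<noteq> y"
      define w where "w = (z + z1)\<^sup>2"
      have w: "w ^ 3 + d * w = c\<^sup>2"
        unfolding w_def by (rule resolvent_cubic_root [OF char3 _ z z1]) (use ne1 in simp)
      have "(y' - y)\<^sup>2 = - d"
        by (rule resolvent_cubic_difference [OF char3 y'(2) y(2) \<open>y' \<noteq> y\<close>])
      moreover have "w = y \<or> (w - y)\<^sup>2 = - d"
        using resolvent_cubic_difference [OF char3 w y(2)] by blast
      ultimately have "w = y \<or> (y' - y)\<^sup>2 = (w - y)\<^sup>2"
        by metis
      hence "\<sigma> (w - y) = w - y"
        using square_eq_square_fixed [of \<sigma> "y' - y" "w - y", OF uminus] y y' by (auto simp: hom)
      hence "(z1 + z2)\<^sup>2 = (z + z1)\<^sup>2"
        using y by (simp add: hom w_def)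
      moreover have "(z2 - z) * (z + z2 - z1 + 3 * z1) = (z1 + z2)\<^sup>2 - (z + z1)\<^sup>2"
        by (simp add: power_algebra_simps)
      ultimately have u: "u = z1"
        using ne char3 by (simp add: u_def)
      have "z2 = - z1"
        using su u by simp
      moreover from this have "z3 = z1"
        using \<open>\<sigma> z1 = z2\<close> \<open>\<sigma> z2 = z3\<close> by (metis uminus minus_minus)
      ultimately show False
        using ne3 by simp
    qed
    hence "{y. \<sigma> y = y \<and> y ^ 3 + d * y = c\<^sup>2} = {y}"
      using y by blast
    thus "\<exists>x. {y. \<sigma> y = y \<and> y ^ 3 + d * y = c\<^sup>2} = {x} \<and> \<not> (\<exists>y. \<sigma> y = y \<and> y\<^sup>2 = x)"
      using nonsq by blast
  next
    assume "\<exists>x. {y. \<sigma> y = y \<and> y ^ 3 + d * y = c\<^sup>2} = {x} \<and> \<not> (\<exists>y. \<sigma> y = y \<and> y\<^sup>2 = x)"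
    then obtain r where eq: "{y. \<sigma> y = y \<and> y ^ 3 + d * y = c\<^sup>2} = {r}"
      and nonsq: "\<And>y. \<sigma> y = y \<Longrightarrow> y\<^sup>2 \<noteq> r"
      by blast
    have r: "\<sigma> r = r" "r ^ 3 + d * r = c\<^sup>2"
      using eq by blast+
    show "\<sigma> (\<sigma> z) \<noteq> z"
    proof
      assume "\<sigma> (\<sigma> z) = z"
      hence z2z: "z2 = z" by simp
      \<comment> \<open>The orbit of \<open>z\<close> has length 1 or 2. In the first case
        \<open>r\<close> has a fixed square root built from \<open>z\<close>; in the second \<sigma>
        swaps \<open>z\<close> and \<open>z1\<close>, so the root \<open>(z + z1)^2\<close> of the
        cubic has the fixed square root \<open>z + z1\<close>.\<close>
      show False
      proof (cases "z1 = z")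
        case True
        have sq: "(c + z * r)\<^sup>2 = r * (r - z\<^sup>2)\<^sup>2"
          by (rule resolvent_cubic_square [OF char3 z r(2)])
        have "r \<noteq> z\<^sup>2"
          using nonsq [of z] True by auto
        hence "((c + z * r) / (r - z\<^sup>2))\<^sup>2 = r"
          using sq by (simp add: power_divide)
        moreover have "\<sigma> ((c + z * r) / (r - z\<^sup>2)) = (c + z * r) / (r - z\<^sup>2)"
          by (simp add: hom r True)
        ultimately show False
          using nonsq by blast
      next
        case False
        hence "((z + z1)\<^sup>2) ^ 3 + d * (z + z1)\<^sup>2 = c\<^sup>2"
          by (intro resolvent_cubic_root [OF char3 _ z z1]) simp
        moreover have "\<sigma> (z + z1) = z + z1"
          by (simp add: hom z2z add.commute)
        ultimately have "(z + z1)\<^sup>2 = r"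
          using eq by (metis (mono_tags, lifting) mem_Collect_eq power singletonD)
        thus False
          using nonsq \<open>\<sigma> (z + z1) = z + z1\<close> by blast
      qed
    qed
  qed
qed

section \<open>Evaluating polynomials over the base field in its algebraic closure\<close>

lemma map_poly_mult_hom:
  fixes h :: "'a::comm_semiring_0 \<Rightarrow> 'b::comm_semiring_0"
  assumes "h 0 = 0" "\<And>x y. h (x + y) = h x + h y" "\<And>x y. h (x * y) = h x * h y"
  shows "map_poly h (p * q) = map_poly h p * map_poly h q"
proof (rule poly_eqI)
  fix n
  have "h (\<Sum>i\<le>n. coeff p i * coeff q (n - i)) = (\<Sum>i\<le>n. h (coeff p i * coeff q (n - i)))"
    using sum_comp_morphism [of h "\<lambda>i. coeff p i * coeff q (n - i)" "{..n}", OF assms(1,2)]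
    by (simp add: o_def)
  thus "coeff (map_poly h (p * q)) n = coeff (map_poly h p * map_poly h q) n"
    by (simp add: coeff_map_poly coeff_mult assms)
qed

lemma poly_map_poly_to_ac_add:
  "poly (map_poly to_ac (p + q)) x = poly (map_poly to_ac p) x + poly (map_poly to_ac q) x"
proof -
  have "map_poly to_ac (p + q) = map_poly to_ac p + map_poly to_ac q"
    by (rule poly_eqI) (simp add: coeff_map_poly)
  thus ?thesis by simp
qed

lemma poly_map_poly_to_ac_mult:
  "poly (map_poly to_ac (p * q)) x = poly (map_poly to_ac p) x * poly (map_poly to_ac q) x"
  by (simp add: map_poly_mult_hom)

lemma poly_map_poly_to_ac_pcompose:
  "poly (map_poly to_ac (pcompose p q)) x = poly (map_poly to_ac p) (poly (map_poly to_ac q) x)"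
  by (induction p)
     (auto simp: pcompose_pCons poly_map_poly_to_ac_add poly_map_poly_to_ac_mult map_poly_pCons)

text \<open>By division with remainder, a nonzero polynomial \<open>p\<close> of least degree
  vanishing at \<open>x\<close> divides \<open>t\<close>. It is not a unit, so the irreducible
  \<open>t\<close> has the same degree.\<close>

lemma irreducible_degree_le:
  fixes t g :: "'a::field poly" and x :: "'a alg_closure"
  assumes t: "Factorial_Ring.irreducible t" "poly (map_poly to_ac t) x = 0"
    and g: "g \<noteq> 0" "poly (map_poly to_ac g) x = 0"
  shows "degree t \<le> degree g"
proof -
  define P where "P = (\<lambda>p::'a poly. p \<noteq> 0 \<and> poly (map_poly to_ac p) x = 0)"
  define p where "p = arg_min degree P"
  have "P g" using g by (simp add: P_def)
  hence p: "P p" and le: "degree p \<le> degree g" and min: "\<And>r. P r \<Longrightarrow> degree p \<le> degree r"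
    unfolding p_def by (auto intro: arg_min_natI arg_min_nat_le)
  have "poly (map_poly to_ac (t div p * p + t mod p)) x = 0"
    using t by simp
  hence "poly (map_poly to_ac (t mod p)) x = 0"
    using p by (simp only: poly_map_poly_to_ac_add poly_map_poly_to_ac_mult P_def) simp
  moreover have "t mod p = 0 \<or> degree (t mod p) < degree p"
    using p by (intro degree_mod_less) (simp add: P_def)
  ultimately have mod: "t mod p = 0"
    using min [of "t mod p"] unfolding P_def by (meson not_le)
  define s where "s = t div p"
  have s: "t = p * s"
    using mult_div_mod_eq [of p t] by (simp add: mod s_def)
  have "\<not> is_unit p"
  proof
    assume "is_unit p"
    hence "degree p = 0"
      using p by (simp add: P_def is_unit_iff_degree)
    then obtain e where "p = [:e:]"
      by (rule degree_eq_zeroE)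
    thus False using p by (simp add: P_def map_poly_pCons)
  qed
  hence "is_unit s"
    using Factorial_Ring.irreducibleD [OF t(1) s] by blast
  hence "degree t = degree p"
    using s p by (cases "s = 0") (auto simp: P_def is_unit_iff_degree degree_mult_eq)
  thus ?thesis using le by simp
qed


section \<open>Frobenius periods and irreducibility\<close>

lemma power_CARD_add:
  "x ^ (CARD('a::finite) ^ (i + j)) = ((x::'b::monoid_mult) ^ (CARD('a) ^ i)) ^ (CARD('a) ^ j)"
  by (simp add: power_add power_mult)

lemma power_CARD_fixed_mult:
  assumes "x ^ (CARD('a::finite) ^ i) = (x::'b::monoid_mult)"
  shows "x ^ (CARD('a) ^ (i * j)) = x"
  using assms by (induction j) (simp_all add: power_CARD_add)

text \<open>This reduces the search for shorter periods to one test at half of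
  \<open>2 ^ Suc n\<close>: a positive \<open>k\<close> below \<open>2 ^ Suc n\<close> has a 2-part
  dividing \<open>2 ^ n\<close>.\<close>

lemma power_two_power_CARD_fixed:
  fixes x :: "'b::monoid_mult"
  assumes "x ^ (CARD('a::finite) ^ (2 ^ Suc n)) = x" "x ^ (CARD('a) ^ k) = x"
    and "0 < k" "k < 2 ^ Suc n"
  shows "x ^ (CARD('a) ^ (2 ^ n)) = x"
proof -
  obtain e l where k: "k = 2 ^ e * l" "odd l"
    using \<open>0 < k\<close> multiplicity_decompose' [of k 2] by (metis gr_implies_not_zero odd_one)
  obtain j where l: "l = 2 * j + 1"
    using k(2) by (elim oddE)
  have "2 ^ e \<le> k"
    using k l by simp
  hence "(2::nat) ^ e < 2 ^ Suc n"
    using assms(4) by linarith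
  hence "e \<le> n"
    by (metis power_strict_increasing_iff one_less_numeral_iff semiring_norm(76) less_Suc_eq_le)
  hence "(2::nat) ^ n = 2 ^ e * 2 ^ (n - e)"
    by (simp flip: power_add)
  \<comment> \<open>An odd multiple of \<open>2 ^ n\<close> that is a multiple of \<open>k\<close> is a period congruent to \<open>2 ^ n\<close>
      modulo the period \<open>2 ^ Suc n\<close>.\<close>
  hence "k * 2 ^ (n - e) = 2 ^ Suc n * j + 2 ^ n"
    by (simp add: k l algebra_simps)
  thus ?thesis
    using power_CARD_fixed_mult [OF assms(2), of "2 ^ (n - e)"]
      power_CARD_fixed_mult [OF assms(1), of j] by (simp add: power_CARD_add)
qed

context
  fixes p m :: nat
  assumes p: "Factorial_Ring.prime p" and card: "CARD('a::{field, finite}) = p ^ m"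
begin

lemma frobenius_add:
  fixes x y :: "'a alg_closure"
  shows "(x + y) ^ (CARD('a) ^ k) = x ^ (CARD('a) ^ k) + y ^ (CARD('a) ^ k)"
proof -
  have "CHAR('a alg_closure) = p"
    using CHAR_eq_of_CARD [OF p card] by simp
  hence "(x + y) ^ (p ^ (m * k)) = x ^ (p ^ (m * k)) + y ^ (p ^ (m * k))"
    by (intro freshmans_dream' [where n = "m * k"]) (use p in auto)
  thus ?thesis
    by (simp add: card flip: power_mult)
qed

lemma frobenius_inj:
  fixes x y :: "'a alg_closure"
  assumes "x ^ (CARD('a) ^ k) = y ^ (CARD('a) ^ k)"
  shows "x = y"
proof -
  have "(x - y) ^ (CARD('a) ^ k) = 0"
    using frobenius_add [of "x - y" y k] assms by simp
  thus ?thesis by simp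
qed

text \<open>The embedded base field has the right size, so uniqueness of the subfield applies. This
  is how coefficients fixed by Frobenius are recognised as base field elements.\<close>

lemma range_to_ac_eq_ext_field: "range to_ac = (ext_field 1 :: 'a alg_closure set)"
proof (rule ext_field_unique [OF p card])
  show "card (range (to_ac :: 'a \<Rightarrow> _)) = CARD('a) ^ 1"
    by (simp add: card_image inj_to_ac)
qed (auto simp flip: to_ac_mult to_ac_inverse intro: range_eqI [of _ _ 0])

lemma to_ac_in_ext_field: "to_ac x \<in> (ext_field k :: 'a alg_closure set)"
proof -
  have "to_ac x \<in> (ext_field 1 :: 'a alg_closure set)"
    using range_to_ac_eq_ext_field by blast
  thus ?thesis
    using power_CARD_fixed_mult [of "to_ac x" 1 k, where 'a = 'a] by (simp add: ext_field_def)
qed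

text \<open>The product of the factors \<open>X - x^(q^i)\<close> for \<open>i < k\<close> is
  invariant under Frobenius, which permutes them cyclically, so its coefficients lie in the base
  field. Any positive period \<open>k\<close> will do, as factors may repeat.\<close>

lemma exists_conjugate_poly:
  fixes x :: "'a alg_closure"
  assumes x: "x ^ (CARD('a) ^ k) = x" and "k > 0"
  obtains g :: "'a poly" where "g \<noteq> 0" "degree g = k" "poly (map_poly to_ac g) x = 0"
proof -
  define \<phi> :: "'a alg_closure \<Rightarrow> 'a alg_closure" where "\<phi> = (\<lambda>y. y ^ CARD('a))"
  define L where "L = (\<lambda>i. [:- (x ^ (CARD('a) ^ i)), 1:])"
  define G where "G = (\<Prod>i<k. L i)"
  have add: "\<phi> (y + z) = \<phi> y + \<phi> z" for y z
    using frobenius_add [of y z 1] by (simp add: \<phi>_def)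
  have zero: "\<phi> 0 = 0"
    by (simp add: \<phi>_def)
  have uminus: "\<phi> (- y) = - \<phi> y" for y
    using add [of y "- y"] zero by (simp add: eq_neg_iff_add_eq_0 add.commute)
  have L: "map_poly \<phi> (L i) = L (Suc i)" for i
    using zero uminus by (simp add: L_def map_poly_pCons)
       (simp add: \<phi>_def mult.commute flip: power_mult)
  have mult: "\<phi> (y * z) = \<phi> y * \<phi> z" and one: "\<phi> 1 = 1" for y z
    by (simp_all add: \<phi>_def power_mult_distrib)
  have "map_poly \<phi> (\<Prod>i\<in>A. L i) = (\<Prod>i\<in>A. map_poly \<phi> (L i))" if "finite A" for A
    using that by induction (simp_all add: map_poly_mult_hom [of \<phi>, OF zero add mult] one)
  hence "map_poly \<phi> G = (\<Prod>i<k. L (Suc i))"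
    by (simp add: G_def L)
  also have "\<dots> = G"
  proof -
    \<comment> \<open>The index shift trades the factor \<open>L 0\<close> for \<open>L k\<close>,
      which equals it and can be cancelled.\<close>
    have "L 0 * (\<Prod>i<k. L (Suc i)) = L k * G"
      unfolding G_def by (metis prod.lessThan_Suc prod.lessThan_Suc_shift mult.commute)
    moreover have "L k = L 0" "L 0 \<noteq> 0"
      using x by (simp_all add: L_def)
    ultimately show ?thesis
      by simp
  qed
  finally have "\<phi> (coeff G i) = coeff G i" for i
    by (metis coeff_map_poly zero)
  hence "coeff G i \<in> range to_ac" for i
    unfolding range_to_ac_eq_ext_field by (simp add: ext_field_def \<phi>_def)
  hence *: "to_ac (of_ac (coeff G i)) = coeff G i" for i
    by (rule to_ac_of_ac)
  define g :: "'a poly" where "g = map_poly of_ac G"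
  have "of_ac 0 = (0::'a)"
    by (rule of_ac_eqI) simp
  hence g: "map_poly to_ac g = G"
    by (intro poly_eqI) (simp add: g_def coeff_map_poly *)
  have "degree G = k"
    unfolding G_def by (subst degree_prod_eq_sum_degree) (auto simp: L_def)
  moreover have "degree (map_poly to_ac g) = degree g"
    by (rule degree_map_poly) simp
  ultimately have "degree g = k"
    using g by simp
  moreover have "poly G x = 0"
    unfolding G_def poly_prod using \<open>k > 0\<close> by (auto simp: L_def intro!: bexI [of _ 0])
  ultimately show thesis
    using \<open>k > 0\<close> g by (intro that [of g]) auto
qed

lemma root_frobenius:
  fixes t :: "'a poly" and x :: "'a alg_closure"
  assumes "poly (map_poly to_ac t) x = 0"
  shows "poly (map_poly to_ac t) (x ^ (CARD('a) ^ k)) = 0"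
proof -
  have "poly (map_poly to_ac t) (y ^ (CARD('a) ^ k)) = poly (map_poly to_ac t) y ^ (CARD('a) ^ k)" for y
  proof (induction t)
    case (pCons e t)
    have "to_ac e ^ (CARD('a) ^ k) = to_ac e"
      using to_ac_in_ext_field [of e k] by (simp add: ext_field_def)
    thus ?case
      using pCons by (simp add: map_poly_pCons frobenius_add power_mult_distrib)
  qed simp
  thus ?thesis
    using assms by simp
qed

text \<open>A period \<open>k\<close> below the degree gives a polynomial of degree \<open>k\<close>
  vanishing at \<open>x\<close>, too small for an irreducible \<open>t\<close>. Without one,
  \<open>x\<close> has \<open>degree t\<close> distinct conjugates, so a factor of \<open>t\<close>
  vanishing at \<open>x\<close> takes up the whole degree.\<close>

lemma irreducible_iff_conjugates:
  fixes t :: "'a poly" and x :: "'a alg_closure"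
  assumes "degree t > 0" and x: "poly (map_poly to_ac t) x = 0"
  shows "Factorial_Ring.irreducible t \<longleftrightarrow>
    (\<forall>k. 0 < k \<and> k < degree t \<longrightarrow> x ^ (CARD('a) ^ k) \<noteq> x)"
proof (intro iffI allI impI notI)
  fix k assume irr: "Factorial_Ring.irreducible t" and k: "0 < k \<and> k < degree t"
    and "x ^ (CARD('a) ^ k) = x"
  then obtain g :: "'a poly" where "g \<noteq> 0" "degree g = k" "poly (map_poly to_ac g) x = 0"
    using exists_conjugate_poly by blast
  thus False
    using irreducible_degree_le [OF irr x] k by fastforce
next
  assume *: "\<forall>k. 0 < k \<and> k < degree t \<longrightarrow> x ^ (CARD('a) ^ k) \<noteq> x"
  \<comment> \<open>Frobenius is injective, so a coincidence of the conjugates \<open>i < j\<close>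
    makes \<open>j - i\<close> a period.\<close>
  have inj: "inj_on (\<lambda>i. x ^ (CARD('a) ^ i)) {..<degree t}"
  proof (rule linorder_inj_onI)
    fix i j assume ij: "i < j" "i \<in> {..<degree t}" "j \<in> {..<degree t}"
    show "x ^ (CARD('a) ^ i) \<noteq> x ^ (CARD('a) ^ j)"
    proof
      assume "x ^ (CARD('a) ^ i) = x ^ (CARD('a) ^ j)"
      hence "x ^ (CARD('a) ^ i) = (x ^ (CARD('a) ^ (j - i))) ^ (CARD('a) ^ i)"
        using ij by (simp flip: power_CARD_add)
      thus False
        using frobenius_inj * ij by (metis lessThan_iff less_imp_diff_less zero_less_diff)
    qed
  qed auto
  have ge: "degree t \<le> degree u" if u: "u \<noteq> 0" "poly (map_poly to_ac u) x = 0" for u :: "'a poly"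
  proof -
    have deg: "degree (map_poly to_ac u) = degree u"
      by (rule degree_map_poly) simp
    have "map_poly to_ac u \<noteq> 0"
      using u(1) by (simp add: map_poly_eq_0_iff)
    moreover have "(\<lambda>i. x ^ (CARD('a) ^ i)) ` {..<degree t} \<subseteq> {y. poly (map_poly to_ac u) y = 0}"
      using root_frobenius [OF u(2)] by auto
    ultimately have "card ((\<lambda>i. x ^ (CARD('a) ^ i)) ` {..<degree t}) \<le> degree u"
      unfolding deg [symmetric]
      by (intro order_trans [OF card_mono card_poly_roots_bound] poly_roots_finite)
    thus ?thesis
      by (simp add: card_image inj)
  qed
  show "Factorial_Ring.irreducible t"
  proof (rule Factorial_Ring.irreducibleI)
    show "t \<noteq> 0"
      using \<open>degree t > 0\<close> by auto
    thus "\<not> is_unit t"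
      using \<open>degree t > 0\<close> by (simp add: is_unit_iff_degree)
    fix u v assume t: "t = u * v"
    hence uv: "u \<noteq> 0" "v \<noteq> 0" "degree t = degree u + degree v"
      using \<open>t \<noteq> 0\<close> by (auto simp: degree_mult_eq)
    have "poly (map_poly to_ac u) x = 0 \<or> poly (map_poly to_ac v) x = 0"
      using x by (simp add: t poly_map_poly_to_ac_mult)
    thus "is_unit u \<or> is_unit v"
      using ge [of u] ge [of v] uv by (auto simp: is_unit_iff_degree)
  qed
qed

text \<open>The degree is the power \<open>2 ^ (2 * n + 2)\<close> of two and
  \<open>4 ^ n + 4 ^ n\<close> is half of it, so every period below the degree forces this
  one.\<close>

lemma irreducible_degree_power_4_iff:
  fixes t :: "'a poly" and x :: "'a alg_closure"
  assumes deg: "degree t = 4 ^ Suc n" and x: "poly (map_poly to_ac t) x = 0" "x \<in> ext_field (4 ^ Suc n)"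
  shows "Factorial_Ring.irreducible t \<longleftrightarrow> x ^ (CARD('a) ^ (4 ^ n + 4 ^ n)) \<noteq> x"
proof -
  have two: "(4::nat) ^ Suc n = 2 ^ Suc (Suc (2 * n))" "(4::nat) ^ n + 4 ^ n = 2 ^ Suc (2 * n)"
    by (simp_all add: power_mult)
  have "x ^ (CARD('a) ^ (2 ^ Suc (2 * n))) = x"
    if "x ^ (CARD('a) ^ k) = x" "0 < k" "k < 4 ^ Suc n" for k
    using power_two_power_CARD_fixed [where 'a = 'a, of x "Suc (2 * n)" k] that x(2)
    unfolding two ext_field_def by simp
  moreover have "(2::nat) ^ Suc (2 * n) < 4 ^ Suc n"
    unfolding two by simp
  ultimately show ?thesis
    using irreducible_iff_conjugates [of t x] x(1) unfolding two(2) deg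
    by (metis zero_less_power zero_less_numeral)
qed

end

section \<open>Iterates of the quartic and the stability criterion\<close>

lemma poly_map_poly_to_ac_iterate:
  "poly (map_poly to_ac (poly_iterate f n)) x = (poly (map_poly to_ac f) ^^ n) x"
  by (induction n) (simp_all add: poly_iterate_def poly_map_poly_to_ac_pcompose map_poly_pCons)

lemma degree_poly_iterate: "degree (poly_iterate (f :: 'a::idom poly) n) = degree f ^ n"
  by (induction n) (simp_all add: poly_iterate_def degree_pcompose)

theorem corollary5p5:
  fixes m :: nat and a b c :: "'a::{field, finite}" and f :: "'a poly"
    and \<alpha> \<beta> :: "nat \<Rightarrow> 'a alg_closure"
  assumes "m \<ge> 1" and "CARD('a) = 3 ^ m"
    and "b \<noteq> 0" and "c \<noteq> 0"
    and "f = smult (b ^ 3) ([:a, 1:] ^ 4) + smult c [:a, 1:] - [:a:]"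
    and "\<alpha> 0 = 0"
    and "\<And>n. n \<ge> 1 \<Longrightarrow> \<alpha> n \<in> ext_field (4 ^ n) \<and> poly (map_poly to_ac f) (\<alpha> n) = \<alpha> (n - 1)"
    and "\<And>n. \<beta> n = to_ac b * (\<alpha> n + to_ac a)"
  shows "stable_poly f \<longleftrightarrow>
    (\<forall>n. \<exists>x. {z \<in> ext_field (4 ^ n). poly [:- (to_ac c ^ 2), \<beta> n, 0, 1:] z = 0} = {x}
              \<and> \<not> (\<exists>y \<in> ext_field (4 ^ n). y ^ 2 = x))"
proof -
  have p: "Factorial_Ring.prime (3::nat)" by simp
  note card = assms(2) and b = assms(3) and c = assms(4) and f = assms(5) and \<beta> = assms(8)
  have "CHAR('a) = 3"
    by (rule CHAR_eq_of_CARD [OF p card])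
  hence char3: "(3::'a alg_closure) = 0"
    using of_nat_CHAR [where 'a = "'a alg_closure"] by simp
  have degree: "degree f = 4"
  proof -
    have "degree (smult (b ^ 3) ([:a, 1:] ^ 4)) = 4"
      using b by (simp add: degree_power_eq)
    moreover have "degree (smult c [:a, 1:] - [:a:]) < 4"
      by (rule le_less_trans [OF degree_diff_le_max]) simp
    ultimately show ?thesis
      unfolding f add_diff_eq [symmetric] by (simp add: degree_add_eq_left)
  qed
  have \<alpha>_ext: "\<alpha> n \<in> ext_field (4 ^ n)" for n
    using assms(6) assms(7) [of n] by (cases "n = 0") (auto simp: ext_field_def)
  have \<alpha>_Suc: "poly (map_poly to_ac f) (\<alpha> (Suc n)) = \<alpha> n" for n
    using assms(7) [of "Suc n"] by simp
  have f_eval: "poly (map_poly to_ac f) x =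
      to_ac b ^ 3 * (x + to_ac a) ^ 4 + to_ac c * (x + to_ac a) - to_ac a" for x
  proof -
    have "f = [:b ^ 3:] * ([:a, 1:] * [:a, 1:] * [:a, 1:] * [:a, 1:]) + [:c:] * [:a, 1:] + [:- a:]"
      unfolding f by (simp add: numeral_eq_Suc)
    thus ?thesis
      by (simp only: poly_map_poly_to_ac_add poly_map_poly_to_ac_mult)
         (simp add: map_poly_pCons algebra_simps power_numeral_reduce)
  qed
  \<comment> \<open>Each application of \<open>f\<close> lowers the index by one, ending at
    \<open>\<alpha> 0 = 0\<close>.\<close>
  have "(poly (map_poly to_ac f) ^^ n) (\<alpha> n) = 0" for n
    by (induction n) (simp_all add: assms(6) \<alpha>_Suc funpow_Suc_right del: funpow.simps)
  hence root: "poly (map_poly to_ac (poly_iterate f n)) (\<alpha> n) = 0" for n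
    by (simp add: poly_map_poly_to_ac_iterate)
  \<comment> \<open>The iterate with index \<open>Suc n\<close> is matched with the cubic at level
    \<open>n\<close>, so iterates counted from 1 correspond to levels counted from 0.\<close>
  have "stable_poly f \<longleftrightarrow> (\<forall>n. Factorial_Ring.irreducible (poly_iterate f (Suc n)))"
    unfolding stable_poly_def by (metis Suc_le_D le_numeral_extra(4) Suc_le_mono le0 One_nat_def)
  also have "\<dots> \<longleftrightarrow> (\<forall>n. \<alpha> (Suc n) ^ (CARD('a) ^ (4 ^ n + 4 ^ n)) \<noteq> \<alpha> (Suc n))"
    by (simp only: irreducible_degree_power_4_iff [OF p card _ root \<alpha>_ext] degree_poly_iterate degree)
  also have "\<dots> \<longleftrightarrow> (\<forall>n. \<exists>x. {z \<in> ext_field (4 ^ n). poly [:- (to_ac c ^ 2), \<beta> n, 0, 1:] z = 0} = {x}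
              \<and> \<not> (\<exists>y \<in> ext_field (4 ^ n). y ^ 2 = x))" (is "(\<forall>n. ?P n) \<longleftrightarrow> (\<forall>n. ?Q n)")
  proof (intro arg_cong [of _ _ All] ext)
    fix n
    \<comment> \<open>The fixed points of this Frobenius power form the field at level
      \<open>n\<close>, and its square is the power map in the irreducibility test.\<close>
    define \<sigma> :: "'a alg_closure \<Rightarrow> 'a alg_closure" where "\<sigma> = (\<lambda>x. x ^ (CARD('a) ^ (4 ^ n)))"
    have add: "\<sigma> (x + y) = \<sigma> x + \<sigma> y" and mult: "\<sigma> (x * y) = \<sigma> x * \<sigma> y" and one: "\<sigma> 1 = 1" for x y
      unfolding \<sigma>_def by (simp_all add: frobenius_add [OF p card] power_mult_distrib)
    have ext: "x \<in> ext_field (4 ^ n) \<longleftrightarrow> \<sigma> x = x" for x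
      by (simp add: ext_field_def \<sigma>_def)
    have base: "\<sigma> (to_ac x) = to_ac x" for x
      using to_ac_in_ext_field [OF p card] ext by blast
    have two: "\<sigma> (\<sigma> x) = x ^ (CARD('a) ^ (4 ^ n + 4 ^ n))" for x
      by (simp add: \<sigma>_def power_CARD_add)
    have "\<sigma> (\<sigma> (\<sigma> (\<sigma> x))) = x ^ (CARD('a) ^ (4 ^ Suc n))" for x
    proof -
      have "(4::nat) ^ n + 4 ^ n + 4 ^ n + 4 ^ n = 4 ^ Suc n"
        by simp
      thus ?thesis
        unfolding \<sigma>_def by (simp only: flip: power_CARD_add)
    qed
    hence "\<sigma> (\<sigma> (\<sigma> (\<sigma> (\<alpha> (Suc n))))) = \<alpha> (Suc n)"
      using \<alpha>_ext [of "Suc n"] by (simp add: ext_field_def)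
    hence period: "\<sigma> (\<sigma> (\<sigma> (\<sigma> (\<beta> (Suc n))))) = \<beta> (Suc n)"
      by (simp add: \<beta> add mult base)
    have fixed: "\<sigma> (\<beta> n) = \<beta> n"
      using \<alpha>_ext [of n] by (simp add: \<beta> add mult base ext)
    \<comment> \<open>The scaling in \<beta> normalises the quartic:
      \<open>b * (f(x) + a) = y^4 + c * y\<close> for \<open>y = b * (x + a)\<close>.\<close>
    have quartic: "\<beta> (Suc n) ^ 4 + to_ac c * \<beta> (Suc n) = \<beta> n"
      unfolding \<beta> \<alpha>_Suc [of n, symmetric] f_eval by (simp add: power_algebra_simps)
    \<comment> \<open>\<open>\<beta> (Suc n)\<close> is an affine function of
      \<open>\<alpha> (Suc n)\<close> with fixed coefficients and nonzero slope \<open>b\<close>, so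
      the square of \<sigma> fixes both or neither.\<close>
    have "?P n \<longleftrightarrow> \<sigma> (\<sigma> (\<beta> (Suc n))) \<noteq> \<beta> (Suc n)"
      using b by (simp add: \<beta> add mult base two [symmetric])
    also have "\<dots> \<longleftrightarrow> (\<exists>x. {y. \<sigma> y = y \<and> y ^ 3 + \<beta> n * y = to_ac c ^ 2} = {x} \<and>
        \<not> (\<exists>y. \<sigma> y = y \<and> y\<^sup>2 = x))"
      using quartic_fixed_iff_resolvent_cubic
        [of \<sigma>, OF char3 add mult one base fixed quartic period] c by simp
    also have "{y. \<sigma> y = y \<and> y ^ 3 + \<beta> n * y = to_ac c ^ 2} =
        {z \<in> ext_field (4 ^ n). poly [:- (to_ac c ^ 2), \<beta> n, 0, 1:] z = 0}"
      by (auto simp: ext algebra_simps power3_eq_cube)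
    finally show "?P n \<longleftrightarrow> ?Q n"
      by (simp add: ext Bex_def)
  qed
  finally show ?thesis .
qed

end
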